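(* Consider the source model in which all source symbols have the same length $L$, in the asymptotic regime described in the context. For any edit probability $\delta\in(0,\frac12)$ and any $a>1$, there exists $\gamma$ with $\delta<\gamma<\frac12$ such that adaptive fixed-length deduplication (AFLD) with parameters $D=L$ and $\gamma$ satisfies, as $B\to\infty$, $$\frac{\mathbb{E}[\mathcal{L}_{AF}(\boldsymbol{s})]}{H(\boldsymbol{s})}\le\frac{a(1+k_1)}{k_2}(1+o(1)).$$
   Context: All logarithms are base 2. $H(p,q)=p\log\frac1q+(1-p)\log\frac1{1-q}$ is the binary cross entropy. Source model (equal symbol lengths). Parameters: positive integers $A,B,L$ and an edit probability $\delta$. Source symbols $X_1,\dots,X_A$ are drawn independently and uniformly from $\{0,1\}^L$ (with replacement). Then, independently for $b=1,\dots,B$, an index $J_b$ is drawn uniformly from $\{1,\dots,A\}$ and the source block $Y_b$ is obtained from $X_{J_b}$ by a $\delta$-edit, i.e. by flipping each bit independently with probability $\delta$. The data stream is $\boldsymbol{s}=Y_1Y_2\cdots Y_B$; $H(\boldsymbol{s})$ is its Shannon entropy in bits. Asymptotic regime. $B\to\infty$; $A$ and $L$ are functions of $B$ tending to infinity with $A\le B^{1-k_2}$ for a fixed $0<k_2<1$ and $L=\Theta(B^{k_1})$ for a fixed $k_1>0$; $\delta\in(0,\frac12)$ is constant. Dictionary encoding of a parsed string. Given a parsing of $\boldsymbol{s}$ into consecutive chunks, the encoding starts with a prefix-free (Elias gamma) encoding of $|\boldsymbol{s}|$ (at most $2\log|\boldsymbol{s}|+3$ bits). Chunks are then processed in order, starting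 with an empty dictionary. A chunk different from all previous chunks is encoded as the bit 1 followed by the chunk itself, and is entered into the dictionary. A chunk equal to an earlier one is encoded as the bit 0 followed by a pointer (index) to its dictionary entry; if the current dictionary has size $t$, the pointer takes $\lceil\log t\rceil$ bits (so at most $\log t+1$). AFLD with parameters $D$ and $\gamma\in(\delta,1/2)$: let $\ell=\left\lceil\frac{\log(B/A)}{H(\gamma,\delta)}\right\rceil$ (and $\ell=D$ if $D$ is smaller than this value). The string $\boldsymbol{s}$ is parsed into consecutive segments of length $D$ (the last one possibly shorter), and each segment is parsed into consecutive chunks of length $\ell$ (the last chunk of a segment possibly shorter). The dictionary encoding is applied to the resulting chunks. $\mathcal{L}_{AF}(\boldsymbol{s})$ is the number of bits AFLD uses to encode $\boldsymbol{s}$. *)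

theory Defs
  imports "HOL-Probability.Probability" "HOL-Library.Landau_Symbols"
begin

section \<open>Source model\<close>

text \<open>Each bit of the list is flipped independently with probability \<open>\<delta>\<close>.\<close>

definition edit_pmf :: "real \<Rightarrow> bool list \<Rightarrow> bool list pmf" where
  "edit_pmf \<delta> x =
     map_pmf (\<lambda>e. map2 (\<noteq>) x e) (replicate_pmf (length x) (bernoulli_pmf \<delta>))"

definition symbols_pmf :: "nat \<Rightarrow> nat \<Rightarrow> bool list list pmf" where
  "symbols_pmf A L = replicate_pmf A (pmf_of_set {x. length x = L})"

definition block_pmf :: "real \<Rightarrow> bool list list \<Rightarrow> bool list pmf" where
  "block_pmf \<delta> Xs = do {j \<leftarrow> pmf_of_set {..<length Xs}; edit_pmf \<delta> (Xs ! j)}"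

definition source_pmf :: "real \<Rightarrow> nat \<Rightarrow> nat \<Rightarrow> nat \<Rightarrow> bool list pmf" where
  "source_pmf \<delta> A B L =
     do {Xs \<leftarrow> symbols_pmf A L; Ys \<leftarrow> replicate_pmf B (block_pmf \<delta> Xs); return_pmf (concat Ys)}"

text \<open>Shannon entropy in bits; the lemma below gives the usual sum for finite support.\<close>

definition pmf_entropy :: "'a pmf \<Rightarrow> real" where
  "pmf_entropy p = prob_space.entropy (measure_pmf p) 2 (count_space UNIV) (\<lambda>x. x)"

lemma pmf_entropy_finite:
  fixes p :: "'a :: countable pmf"
  assumes "finite (set_pmf p)"
  shows "pmf_entropy p = - (\<Sum>x\<in>set_pmf p. pmf p x * log 2 (pmf p x))"
proof -
  interpret information_space "measure_pmf p" 2
    by (simp add: information_space_def information_space_axioms_def measure_pmf.prob_space_axioms)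
  have "distributed (measure_pmf p) (count_space UNIV) (\<lambda>x. x) (pmf p)"
    unfolding distributed_def
    by (auto simp: measure_pmf_eq_density[symmetric] distr_id2)
  then have "pmf_entropy p = - (\<integral>x. pmf p x * log 2 (pmf p x) \<partial>count_space UNIV)"
    unfolding pmf_entropy_def by (rule entropy_distr) auto
  also have "(\<integral>x. pmf p x * log 2 (pmf p x) \<partial>count_space UNIV) =
      (\<Sum>x | pmf p x * log 2 (pmf p x) \<noteq> 0. pmf p x * log 2 (pmf p x))"
    by (subst lebesgue_integral_count_space_finite_support)
      (auto intro: finite_subset[OF _ assms] simp: set_pmf_iff)
  also have "\<dots> = (\<Sum>x\<in>set_pmf p. pmf p x * log 2 (pmf p x))"
    by (rule sum.mono_neutral_left) (use assms in \<open>auto simp: set_pmf_iff\<close>)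
  finally show ?thesis .
qed

text \<open>\<open>A\<close> and \<open>L\<close> are indexed by \<open>B\<close>; their positivity for large \<open>B\<close> follows from the limits.\<close>

definition asymptotic_regime :: "real \<Rightarrow> real \<Rightarrow> (nat \<Rightarrow> nat) \<Rightarrow> (nat \<Rightarrow> nat) \<Rightarrow> bool" where
  "asymptotic_regime k1 k2 A L \<longleftrightarrow>
     0 < k1 \<and> 0 < k2 \<and> k2 < 1 \<and>
     filterlim A at_top sequentially \<and> filterlim L at_top sequentially \<and>
     (\<forall>\<^sub>F B in sequentially. real (A B) \<le> real B powr (1 - k2)) \<and>
     (\<lambda>B. real (L B)) \<in> \<Theta>(\<lambda>B. real B powr k1)"


section \<open>Dictionary encoding\<close>

text \<open>Big-endian binary representation with exactly \<open>w\<close> bits.\<close>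

definition fixed_width :: "nat \<Rightarrow> nat \<Rightarrow> bool list" where
  "fixed_width w n = rev (map (bit n) [0..<w])"

definition elias_gamma :: "nat \<Rightarrow> bool list" where
  "elias_gamma n =
     (let k = nat \<lfloor>log 2 (real n)\<rfloor> in replicate k False @ fixed_width (Suc k) n)"

text \<open>The first argument is the current dictionary, in order of insertion; the pointer is the
  position of the chunk in it.\<close>

fun encode_chunks :: "bool list list \<Rightarrow> bool list list \<Rightarrow> bool list" where
  "encode_chunks d [] = []"
| "encode_chunks d (c # cs) =
     (if c \<in> set d
      then False # fixed_width (nat \<lceil>log 2 (real (length d))\<rceil>) (LEAST i. i < length d \<and> d ! i = c)
             @ encode_chunks d cs
      else True # c @ encode_chunks (d @ [c]) cs)"

definition dictionary_encoding :: "bool list list \<Rightarrow> bool list" where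
  "dictionary_encoding cs = elias_gamma (length (concat cs)) @ encode_chunks [] cs"


section \<open>Adaptive fixed-length deduplication\<close>

definition cross_entropy :: "real \<Rightarrow> real \<Rightarrow> real" where
  "cross_entropy p q = p * log 2 (1 / q) + (1 - p) * log 2 (1 / (1 - q))"

text \<open>Consecutive pieces of length \<open>n\<close>, the last one possibly shorter. The case \<open>n = 0\<close> (no cutting)
  only makes the function total.\<close>

fun pieces :: "nat \<Rightarrow> 'a list \<Rightarrow> 'a list list" where
  "pieces n xs =
     (if xs = [] then [] else if n = 0 then [xs] else take n xs # pieces n (drop n xs))"

declare pieces.simps [simp del]

definition afld_chunk_length :: "real \<Rightarrow> nat \<Rightarrow> nat \<Rightarrow> nat \<Rightarrow> real \<Rightarrow> nat" where
  "afld_chunk_length \<delta> A B D \<gamma> =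
     min D (nat \<lceil>log 2 (real B / real A) / cross_entropy \<gamma> \<delta>\<rceil>)"

definition afld :: "real \<Rightarrow> nat \<Rightarrow> nat \<Rightarrow> nat \<Rightarrow> real \<Rightarrow> bool list \<Rightarrow> bool list" where
  "afld \<delta> A B D \<gamma> s =
     dictionary_encoding (concat (map (pieces (afld_chunk_length \<delta> A B D \<gamma>)) (pieces D s)))"

definition afld_bits :: "real \<Rightarrow> nat \<Rightarrow> nat \<Rightarrow> nat \<Rightarrow> real \<Rightarrow> bool list \<Rightarrow> nat" where
  "afld_bits \<delta> A B D \<gamma> s = length (afld \<delta> A B D \<gamma> s)"

end

theory Submission
  imports Defs "HOL-Real_Asymp.Real_Asymp"
begin

text \<open>
  Given the source symbols, every block is a mixture of edits, and an edit has entropy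
  \<open>L H(\<delta>, \<delta>)\<close>; as conditioning reduces entropy, \<open>H(s) \<ge> B L H(\<delta>, \<delta>)\<close>.

  The code length is dominated by the pointers: there are about \<open>B L / \<ell>\<close> of them, each of at most
  \<open>log (B L) + O(1) = (1 + k\<^sub>1) log B + O(1)\<close> bits, and \<open>\<ell> \<ge> k\<^sub>2 log B / H(\<gamma>, \<delta>)\<close>. It remains to choose \<open>\<gamma>\<close>
  with \<open>H(\<gamma>, \<delta>) \<le> a H(\<delta>, \<delta>)\<close> and to see that the dictionary entries cost only \<open>o(B L)\<close> bits. Fix
  \<open>\<delta> < \<gamma>' < \<gamma>\<close> and call a chunk of an edit pattern typical if at most \<open>\<gamma>' \<ell>\<close> of its bits are flips. There
  are at most \<open>2\<close> to the power \<open>\<ell> H(\<gamma>', \<delta>)\<close> typical patterns, because each has probability at least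
  the inverse of this number, so the chunks they produce cost at most about
  \<open>A L\<close> times the power of \<open>B / A\<close> with exponent \<open>H(\<gamma>', \<delta>) / H(\<gamma>, \<delta>) < 1\<close>, which is \<open>o(B L)\<close>. The atypical ones have
  probability tending to \<open>0\<close> by Hoeffding's inequality, and the incomplete chunks, at most one per
  block, are negligible.
\<close>

section \<open>Expectations over finitely supported distributions\<close>

lemma expectation_bind_pmf_finite:
  fixes g :: "'b \<Rightarrow> real"
  assumes "finite (set_pmf p)" "\<And>x. x \<in> set_pmf p \<Longrightarrow> finite (set_pmf (f x))"
  shows "measure_pmf.expectation (bind_pmf p f) g =
    measure_pmf.expectation p (\<lambda>x. measure_pmf.expectation (f x) g)"
  using assms by (subst pmf_expectation_bind[where A = "set_pmf p"], simp, simp, simp)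
    (subst integral_measure_pmf_real[where A = "set_pmf p"], auto simp: mult.commute)

lemma expectation_mono_finite:
  fixes g h :: "'a \<Rightarrow> real"
  assumes "finite (set_pmf p)" "\<And>x. x \<in> set_pmf p \<Longrightarrow> g x \<le> h x"
  shows "measure_pmf.expectation p g \<le> measure_pmf.expectation p h"
  using assms by (intro integral_mono_AE integrable_measure_pmf_finite) (auto simp: AE_measure_pmf_iff)

lemma expectation_le_const_finite:
  fixes g :: "'a \<Rightarrow> real"
  assumes "finite (set_pmf p)" "\<And>x. x \<in> set_pmf p \<Longrightarrow> g x \<le> c"
  shows "measure_pmf.expectation p g \<le> c"
  using expectation_mono_finite[of p g "\<lambda>_. c"] assms by simp

lemma expectation_ge_const_finite:
  fixes g :: "'a \<Rightarrow> real"
  assumes "finite (set_pmf p)" "\<And>x. x \<in> set_pmf p \<Longrightarrow> c \<le> g x"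
  shows "c \<le> measure_pmf.expectation p g"
  using expectation_mono_finite[of p "\<lambda>_. c" g] assms by simp

lemma expectation_cong_pmf:
  fixes g h :: "'a \<Rightarrow> real"
  assumes "\<And>x. x \<in> set_pmf p \<Longrightarrow> g x = h x"
  shows "measure_pmf.expectation p g = measure_pmf.expectation p h"
  using assms by (intro integral_cong_AE) (auto simp: AE_measure_pmf_iff)

lemma finite_set_replicate_pmf:
  "finite (set_pmf p) \<Longrightarrow> finite (set_pmf (replicate_pmf n p))"
  using finite_lists_length_eq[of "set_pmf p" n] by (auto simp: set_replicate_pmf lists_eq_set)

section \<open>Entropy\<close>

lemma pmf_entropy_expectation:
  fixes p :: "'a :: countable pmf"
  assumes "finite (set_pmf p)"
  shows "pmf_entropy p = measure_pmf.expectation p (\<lambda>x. - log 2 (pmf p x))"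
  using assms by (simp add: pmf_entropy_finite integral_measure_pmf_real[where A = "set_pmf p"] mult.commute)

text \<open>Apply ln t \<le> t - 1 to the ratio of \<open>r\<close> to \<open>p\<close>: the
  expectation of this ratio under \<open>p\<close> is the mass that \<open>r\<close> gives to the
  support of \<open>p\<close>, hence at most 1. The inclusion of supports keeps \<open>log\<close>
  away from its default value at 0.\<close>

lemma pmf_entropy_Gibbs:
  fixes p :: "'a :: countable pmf"
  assumes fin: "finite (set_pmf p)" "finite (set_pmf r)" and sub: "set_pmf p \<subseteq> set_pmf r"
  shows "pmf_entropy p \<le> measure_pmf.expectation p (\<lambda>x. - log 2 (pmf r x))"
proof -
  let ?E = "measure_pmf.expectation p"
  have "?E (\<lambda>x. log 2 (pmf r x) - log 2 (pmf p x)) \<le> ?E (\<lambda>x. (pmf r x / pmf p x - 1) / ln 2)"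
  proof (rule expectation_mono_finite[OF fin(1)])
    fix x assume x: "x \<in> set_pmf p"
    then have pos: "pmf p x > 0" "pmf r x > 0" using sub by (auto simp: pmf_positive)
    have "log 2 (pmf r x) - log 2 (pmf p x) = ln (pmf r x / pmf p x) / ln 2"
      using pos by (simp add: log_def ln_div diff_divide_distrib)
    also have "\<dots> \<le> (pmf r x / pmf p x - 1) / ln 2"
      using pos by (intro divide_right_mono ln_le_minus_one) auto
    finally show "log 2 (pmf r x) - log 2 (pmf p x) \<le> (pmf r x / pmf p x - 1) / ln 2" .
  qed
  also have "\<dots> = (\<Sum>x\<in>set_pmf p. (pmf r x - pmf p x) / ln 2)"
    using fin by (subst integral_measure_pmf_real[where A = "set_pmf p"])
      (auto intro!: sum.cong simp: set_pmf_iff field_simps)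
  also have "\<dots> = (sum (pmf r) (set_pmf p) - 1) / ln 2"
    using sum_pmf_eq_1[OF fin(1)] by (simp add: sum_divide_distrib[symmetric] sum_subtractf)
  also have "\<dots> \<le> 0"
    using measure_pmf.prob_le_1[of r "set_pmf p"]
    by (simp add: measure_measure_pmf_finite[OF fin(1)] divide_nonpos_pos)
  finally show ?thesis
    using fin(1) by (simp add: pmf_entropy_expectation integrable_measure_pmf_finite)
qed

text \<open>Gibbs' inequality with the mixture as reference bounds the entropy of each component by
  its cross entropy against the mixture. Averaged over the components, these cross entropies give
  exactly the entropy of the mixture.\<close>

lemma pmf_entropy_bind_ge:
  fixes f :: "'a \<Rightarrow> 'b :: countable pmf"
  assumes fin: "finite (set_pmf p)" "\<And>x. x \<in> set_pmf p \<Longrightarrow> finite (set_pmf (f x))"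
    and ge: "\<And>x. x \<in> set_pmf p \<Longrightarrow> c \<le> pmf_entropy (f x)"
  shows "c \<le> pmf_entropy (bind_pmf p f)"
proof -
  have fin': "finite (set_pmf (bind_pmf p f))" using fin by simp
  have le: "c \<le> measure_pmf.expectation (f x) (\<lambda>y. - log 2 (pmf (bind_pmf p f) y))"
    if "x \<in> set_pmf p" for x
    using ge[OF that] pmf_entropy_Gibbs[OF fin(2)[OF that] fin'] that by force
  have "c \<le> measure_pmf.expectation p
      (\<lambda>x. measure_pmf.expectation (f x) (\<lambda>y. - log 2 (pmf (bind_pmf p f) y)))"
    by (intro expectation_ge_const_finite fin le)
  also have "\<dots> = pmf_entropy (bind_pmf p f)"
    unfolding pmf_entropy_expectation[OF fin'] using fin
    by (rule expectation_bind_pmf_finite[symmetric])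
  finally show ?thesis .
qed

lemma pmf_entropy_map_inj_on:
  fixes f :: "'a :: countable \<Rightarrow> 'b :: countable"
  assumes "finite (set_pmf p)" "inj_on f (set_pmf p)"
  shows "pmf_entropy (map_pmf f p) = pmf_entropy p"
  using assms
  by (simp add: pmf_entropy_expectation cong: expectation_cong_pmf)
    (intro expectation_cong_pmf, simp add: pmf_map_inj)

lemma pmf_replicate_pmf_Cons:
  "pmf (replicate_pmf (Suc n) p) (x # xs) = pmf p x * pmf (replicate_pmf n p) xs"
proof -
  let ?f = "\<lambda>(x, xs). x # xs"
  have "replicate_pmf (Suc n) p = map_pmf ?f (pair_pmf p (replicate_pmf n p))"
    by (simp add: pair_pmf_def map_bind_pmf map_pmf_def bind_assoc_pmf bind_return_pmf)
  moreover have "pmf (map_pmf ?f (pair_pmf p (replicate_pmf n p))) (?f (x, xs)) =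
      pmf (pair_pmf p (replicate_pmf n p)) (x, xs)"
    by (rule pmf_map_inj') (auto simp: inj_on_def)
  ultimately show ?thesis by (simp add: pmf_pair)
qed

lemma pmf_entropy_replicate:
  fixes p :: "'a :: countable pmf"
  assumes fin: "finite (set_pmf p)"
  shows "pmf_entropy (replicate_pmf n p) = n * pmf_entropy p"
proof (induction n)
  case 0
  show ?case by (simp add: pmf_entropy_finite)
next
  case (Suc n)
  let ?r = "replicate_pmf n p"
  note fins = fin finite_set_replicate_pmf[OF fin, of n] finite_set_replicate_pmf[OF fin, of "Suc n"]
  have "pmf_entropy (replicate_pmf (Suc n) p) =
      measure_pmf.expectation p (\<lambda>x. measure_pmf.expectation ?r
        (\<lambda>xs. - log 2 (pmf (replicate_pmf (Suc n) p) (x # xs))))"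
    unfolding pmf_entropy_expectation[OF fins(3)]
    using fins by (simp add: expectation_bind_pmf_finite)
  also have "\<dots> = measure_pmf.expectation p (\<lambda>x. measure_pmf.expectation ?r
        (\<lambda>xs. - log 2 (pmf p x) + - log 2 (pmf ?r xs)))"
    \<comment> \<open>Splitting the logarithm of the product requires nonzero factors, so the
      integrands are compared on the supports only.\<close>
    unfolding pmf_replicate_pmf_Cons
    by (intro expectation_cong_pmf) (auto simp: log_mult set_pmf_iff)
  also have "\<dots> = pmf_entropy p + pmf_entropy ?r"
    using fins by (simp add: pmf_entropy_expectation integrable_measure_pmf_finite)
  finally show ?case using Suc by (simp add: algebra_simps)
qed

section \<open>Entropy of edits, blocks and the source\<close>

lemma pmf_entropy_bernoulli:
  assumes "0 < \<delta>" "\<delta> < 1"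
  shows "pmf_entropy (bernoulli_pmf \<delta>) = cross_entropy \<delta> \<delta>"
  using assms by (subst pmf_entropy_finite)
    (auto simp: set_pmf_bernoulli UNIV_bool cross_entropy_def log_divide)

text \<open>A common block length makes the block boundaries recoverable, so concatenating the
  blocks of the source loses no entropy.\<close>

lemma inj_on_concat_same_length:
  assumes "0 < L" "\<And>Ys. Ys \<in> S \<Longrightarrow> (\<forall>Y\<in>set Ys. length Y = L) \<and> length Ys = n"
  shows "inj_on concat S"
proof (rule inj_onI)
  fix Ys Zs assume *: "Ys \<in> S" "Zs \<in> S" "concat Ys = concat Zs"
  then have "length Ys = length Zs" using assms(2) by metis
  then show "Ys = Zs"
    using *(3) assms(2)[OF *(1)] assms(2)[OF *(2)]
    by (intro concat_injective) (auto, metis set_zip_leftD set_zip_rightD)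
qed

text \<open>The flip pattern can be read off from \<open>x\<close> and the edited word;
  \<open>zip\<close> truncates, hence the restriction to patterns as long as \<open>x\<close>. An
  edit therefore has the entropy of its flip pattern.\<close>

lemma inj_on_map2_neq: "inj_on (map2 (\<noteq>) x) {e. length e = length (x :: bool list)}"
proof (rule inj_onI)
  fix e e' :: "bool list"
  assume *: "e \<in> {e. length e = length x}" "e' \<in> {e. length e = length x}"
    and eq: "map2 (\<noteq>) x e = map2 (\<noteq>) x e'"
  show "e = e'"
  proof (rule nth_equalityI)
    fix i assume "i < length e"
    then have "map2 (\<noteq>) x e ! i = (x ! i \<noteq> e ! i)" "map2 (\<noteq>) x e' ! i = (x ! i \<noteq> e' ! i)"
      using * by auto
    then show "e ! i = e' ! i" using eq by auto
  qed (use * in simp)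
qed

lemma set_edit_pmf_length: "y \<in> set_pmf (edit_pmf \<delta> x) \<Longrightarrow> length y = length x"
  by (auto simp: edit_pmf_def set_replicate_pmf)

lemma finite_set_edit_pmf: "finite (set_pmf (edit_pmf \<delta> x))"
  by (simp add: edit_pmf_def finite_set_replicate_pmf)

lemma pmf_entropy_edit:
  assumes "0 < \<delta>" "\<delta> < 1"
  shows "pmf_entropy (edit_pmf \<delta> x) = length x * cross_entropy \<delta> \<delta>"
proof -
  have "inj_on (map2 (\<noteq>) x) (set_pmf (replicate_pmf (length x) (bernoulli_pmf \<delta>)))"
    by (rule inj_on_subset[OF inj_on_map2_neq]) (auto simp: set_replicate_pmf)
  then show ?thesis
    using assms
    by (simp add: edit_pmf_def pmf_entropy_map_inj_on finite_set_replicate_pmf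
        pmf_entropy_replicate pmf_entropy_bernoulli)
qed

lemma set_symbols_pmf:
  "set_pmf (symbols_pmf A L) = {Xs. length Xs = A \<and> (\<forall>X\<in>set Xs. length X = L)}"
proof -
  have "finite {x :: bool list. length x = L}" "{x :: bool list. length x = L} \<noteq> {}"
    using finite_lists_length_eq[of "UNIV :: bool set" L] Ex_list_of_length[of L] by auto
  then show ?thesis by (auto simp: symbols_pmf_def set_replicate_pmf)
qed

lemma finite_set_symbols_pmf: "finite (set_pmf (symbols_pmf A L))"
proof -
  have "finite {x :: bool list. length x = L}"
    using finite_lists_length_eq[of "UNIV :: bool set" L] by auto
  then show ?thesis
    using finite_lists_length_eq[of "{x :: bool list. length x = L}" A]
    by (simp add: set_symbols_pmf conj_commute subset_eq)
qed

context
  fixes A L :: nat and Xs :: "bool list list"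
  assumes A: "0 < A" and Xs: "Xs \<in> set_pmf (symbols_pmf A L)"
begin

text \<open>The support of \<open>pmf_of_set\<close> is known only for nonempty finite sets; this is
  where A > 0 enters.\<close>

lemma set_index_pmf: "set_pmf (pmf_of_set {..<length Xs}) = {..<A}"
  using A Xs by (subst set_pmf_of_set) (auto simp: set_symbols_pmf)

lemma finite_set_block_pmf: "finite (set_pmf (block_pmf \<delta> Xs))"
  by (simp add: block_pmf_def set_index_pmf finite_set_edit_pmf)

lemma set_block_pmf_length: "Y \<in> set_pmf (block_pmf \<delta> Xs) \<Longrightarrow> length Y = L"
  using A Xs by (auto simp: block_pmf_def set_index_pmf set_symbols_pmf dest!: set_edit_pmf_length)

lemma pmf_entropy_block_ge:
  assumes "0 < \<delta>" "\<delta> < 1"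
  shows "L * cross_entropy \<delta> \<delta> \<le> pmf_entropy (block_pmf \<delta> Xs)"
  unfolding block_pmf_def
  using Xs assms
  by (intro pmf_entropy_bind_ge finite_set_edit_pmf)
    (auto simp: set_index_pmf pmf_entropy_edit set_symbols_pmf)

lemma finite_set_blocks_pmf: "finite (set_pmf (replicate_pmf B (block_pmf \<delta> Xs)))"
  by (intro finite_set_replicate_pmf finite_set_block_pmf)

end

lemma source_pmf_alt:
  "source_pmf \<delta> A B L = bind_pmf (symbols_pmf A L) (\<lambda>Xs. map_pmf concat (replicate_pmf B (block_pmf \<delta> Xs)))"
  by (simp add: source_pmf_def map_pmf_def)

lemma pmf_entropy_source_ge:
  assumes "0 < \<delta>" "\<delta> < 1" "0 < A" "0 < L"
  shows "real B * real L * cross_entropy \<delta> \<delta> \<le> pmf_entropy (source_pmf \<delta> A B L)"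
  unfolding source_pmf_alt
proof (rule pmf_entropy_bind_ge)
  fix Xs assume Xs: "Xs \<in> set_pmf (symbols_pmf A L)"
  show fin: "finite (set_pmf (map_pmf concat (replicate_pmf B (block_pmf \<delta> Xs))))"
    using finite_set_blocks_pmf[OF assms(3) Xs] by simp
  \<comment> \<open>For fixed source symbols the blocks are i.i.d., so their entropies add up and
    survive the concatenation.\<close>
  have "inj_on concat (set_pmf (replicate_pmf B (block_pmf \<delta> Xs)))"
    using assms(4) set_block_pmf_length[OF assms(3) Xs, of _ \<delta>]
    by (intro inj_on_concat_same_length[of L _ B]) (auto simp: set_replicate_pmf)
  then have "pmf_entropy (map_pmf concat (replicate_pmf B (block_pmf \<delta> Xs))) = B * pmf_entropy (block_pmf \<delta> Xs)"
    using finite_set_blocks_pmf[OF assms(3) Xs] finite_set_block_pmf[OF assms(3) Xs]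
    by (simp add: pmf_entropy_map_inj_on pmf_entropy_replicate)
  then show "real B * real L * cross_entropy \<delta> \<delta>
      \<le> pmf_entropy (map_pmf concat (replicate_pmf B (block_pmf \<delta> Xs)))"
    using pmf_entropy_block_ge[OF assms(3) Xs assms(1,2)]
    by (simp add: mult.assoc mult_left_mono)
qed (rule finite_set_symbols_pmf)

section \<open>Length of the encoding\<close>

lemma length_fixed_width [simp]: "length (fixed_width w n) = w"
  by (simp add: fixed_width_def)

lemma length_elias_gamma_le:
  assumes "0 < n"
  shows "real (length (elias_gamma n)) \<le> 2 * log 2 n + 1"
proof -
  have "0 \<le> log 2 (real n)" using assms by simp
  then have "real (nat \<lfloor>log 2 (real n)\<rfloor>) \<le> log 2 n" by linarith
  then show ?thesis by (simp add: elias_gamma_def Let_def)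
qed

text \<open>The dictionary grows by at most one entry per chunk, so \<open>N\<close> bounds its size
  throughout. Every chunk, new or old, is charged a flag and a pointer of maximal width; in addition
  each distinct new chunk is charged its own length once.\<close>

lemma length_encode_chunks_le:
  assumes "length d + length cs \<le> N"
  shows "length (encode_chunks d cs) \<le>
    length cs * (1 + nat \<lceil>log 2 N\<rceil>) + (\<Sum>c\<in>set cs - set d. length c)"
  using assms
proof (induction d cs rule: encode_chunks.induct)
  case (1 d)
  then show ?case by simp
next
  case (2 d c cs)
  show ?case
  proof (cases "c \<in> set d")
    case True
    then have "0 < length d" by auto
    then have "log 2 (real (length d)) \<le> log 2 N" using 2(3) by simp
    then have "nat \<lceil>log 2 (real (length d))\<rceil> \<le> nat \<lceil>log 2 N\<rceil>"
      by (intro nat_mono ceiling_mono)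
    moreover have "length (encode_chunks d cs) \<le>
        length cs * (1 + nat \<lceil>log 2 N\<rceil>) + (\<Sum>c\<in>set cs - set d. length c)"
      using 2(1)[OF True] 2(3) by simp
    moreover have "set (c # cs) - set d = set cs - set d" using True by auto
    ultimately show ?thesis using True
      by (simp only: encode_chunks.simps if_True length_Cons length_append length_fixed_width add_mult_distrib mult_Suc)
  next
    case False
    have "set (c # cs) - set d = insert c (set cs - set (d @ [c]))" using False by auto
    then have "(\<Sum>c\<in>set (c # cs) - set d. length c) =
        length c + (\<Sum>c\<in>set cs - set (d @ [c]). length c)" by simp
    then show ?thesis using 2(2)[OF False] 2(3) False by simp
  qed
qed

section \<open>Parsing and the number of distinct chunks\<close>

lemma concat_pieces [simp]: "concat (pieces n xs) = xs"
  by (induction n xs rule: pieces.induct) (subst pieces.simps, simp)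

text \<open>With D = L the segments are exactly the source blocks, so no chunk straddles two
  blocks.\<close>

lemma pieces_concat:
  assumes "0 < n" "\<And>y. y \<in> set ys \<Longrightarrow> length y = n"
  shows "pieces n (concat ys) = ys"
  using assms(2)
proof (induction ys)
  case Nil
  show ?case by (simp add: pieces.simps)
next
  case (Cons y ys)
  then have "length y = n" "y \<noteq> []" using assms(1) by auto
  then show ?case using Cons assms(1) by (subst pieces.simps) simp
qed

text \<open>The first bound counts the pointers, with one possibly incomplete chunk per block. The
  second holds because no piece is empty; it bounds the dictionary size, and so the pointer width,
  in terms of the number of bits alone.\<close>

lemma length_pieces_le:
  assumes "0 < n"
  shows "length (pieces n xs) \<le> Suc (length xs div n)" "length (pieces n xs) \<le> length xs"
proof -
  have "length (pieces n xs) \<le> Suc (length xs div n) \<and> length (pieces n xs) \<le> length xs"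
    using assms
  proof (induction n xs rule: pieces.induct)
    case (1 n xs)
    consider "xs = []" | "xs \<noteq> []" "length xs \<le> n" | "n < length xs" by linarith
    then show ?case
    proof cases
      case 3
      then have "length xs div n = Suc ((length xs - n) div n)"
        using 1(2) by (simp add: le_div_geq)
      then show ?thesis using 1 3 by (subst (1 2) pieces.simps) auto
    qed (use 1 in \<open>subst (1 2) pieces.simps, simp add: pieces.simps Suc_le_eq\<close>)+
  qed
  then show "length (pieces n xs) \<le> Suc (length xs div n)" "length (pieces n xs) \<le> length xs"
    by auto
qed

text \<open>Indices below \<open>length xs div n\<close> give the full chunks; the index
  \<open>length xs div n\<close> itself gives the remainder, which is empty if \<open>n\<close>
  divides the length.\<close>

definition chunk :: "nat \<Rightarrow> nat \<Rightarrow> 'a list \<Rightarrow> 'a list" where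
  "chunk n i xs = take n (drop (i * n) xs)"

lemma set_pieces_subset:
  assumes "0 < n"
  shows "set (pieces n xs) \<subseteq> (\<lambda>i. chunk n i xs) ` {..length xs div n}"
  using assms
proof (induction n xs rule: pieces.induct)
  case (1 n xs)
  show ?case
  proof
    fix c assume c: "c \<in> set (pieces n xs)"
    then have ne: "xs \<noteq> []" by (auto simp: pieces.simps)
    then consider "c = take n xs" | "c \<in> set (pieces n (drop n xs))"
      using c 1(2) by (subst (asm) pieces.simps) auto
    then show "c \<in> (\<lambda>i. chunk n i xs) ` {..length xs div n}"
    proof cases
      case 1
      then show ?thesis by (intro image_eqI[of _ _ 0]) (auto simp: chunk_def)
    next
      case 2
      then have "drop n xs \<noteq> []" by (auto simp: pieces.simps)
      then have "n < length xs" by simp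
      then have div: "length xs div n = Suc ((length xs - n) div n)"
        using 1(2) by (simp add: le_div_geq)
      obtain i where "i \<le> (length xs - n) div n" "c = chunk n i (drop n xs)"
        using 2 1 ne by auto
      then show ?thesis
        using div by (intro image_eqI[of _ _ "Suc i"]) (auto simp: chunk_def add.commute)
    qed
  qed
qed

lemma card_UN_list_le: "card (\<Union>y\<in>set ys. F y) \<le> (\<Sum>y\<leftarrow>ys. card (F y))"
proof (induction ys)
  case (Cons y ys)
  have "card (\<Union>z\<in>set (y # ys). F z) \<le> card (F y) + card (\<Union>z\<in>set ys. F z)"
    by (simp add: card_Un_le)
  then show ?case using Cons by simp
qed simp

text \<open>Three kinds of chunks are counted: the remainders, at most one per block; the members of
  \<open>T\<close>; and the full chunks outside \<open>T\<close>, counted with multiplicity. The set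
  \<open>T\<close> is left open, to be filled with the chunks that typical edits produce.\<close>

lemma card_chunks_le:
  assumes n: "0 < n" and len: "\<And>y. y \<in> set ys \<Longrightarrow> length y = L" and T: "finite T"
  shows "card (\<Union>y\<in>set ys. set (pieces n y)) \<le>
    length ys + card T + (\<Sum>y\<leftarrow>ys. card {i. i < L div n \<and> chunk n i y \<notin> T})"
proof -
  let ?I = "\<lambda>y. {i. i < L div n \<and> chunk n i y \<notin> T}"
  let ?F = "\<lambda>y. (\<lambda>i. chunk n i y) ` ?I y"
  have "(\<Union>y\<in>set ys. set (pieces n y)) \<subseteq> chunk n (L div n) ` set ys \<union> T \<union> (\<Union>y\<in>set ys. ?F y)"
  proof
    fix c assume "c \<in> (\<Union>y\<in>set ys. set (pieces n y))"
    then obtain y i where "y \<in> set ys" "c = chunk n i y" "i \<le> L div n"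
      using set_pieces_subset[OF n] len by fastforce
    then show "c \<in> chunk n (L div n) ` set ys \<union> T \<union> (\<Union>y\<in>set ys. ?F y)"
      by (cases "i = L div n"; cases "c \<in> T"; force)
  qed
  then have "card (\<Union>y\<in>set ys. set (pieces n y)) \<le>
      card (chunk n (L div n) ` set ys \<union> T \<union> (\<Union>y\<in>set ys. ?F y))"
    using T by (intro card_mono) auto
  also have "\<dots> \<le> card (chunk n (L div n) ` set ys) + card T + card (\<Union>y\<in>set ys. ?F y)"
    by (rule order.trans[OF card_Un_le add_right_mono[OF card_Un_le]])
  also have "card (chunk n (L div n) ` set ys) \<le> length ys"
    by (rule order.trans[OF card_image_le card_length]) simp
  also have "card (\<Union>y\<in>set ys. ?F y) \<le> (\<Sum>y\<leftarrow>ys. card (?F y))"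
    by (rule card_UN_list_le)
  also have "\<dots> \<le> (\<Sum>y\<leftarrow>ys. card (?I y))"
    by (intro sum_list_mono card_image_le) auto
  finally show ?thesis by simp
qed

lemma afld_bits_le:
  fixes A B L :: nat and \<delta> \<gamma> :: real
  defines "n \<equiv> afld_chunk_length \<delta> A B L \<gamma>"
  assumes n: "0 < n" and L: "0 < L" and B: "0 < B" and T: "finite T"
    and Ys: "length Ys = B" "\<And>y. y \<in> set Ys \<Longrightarrow> length y = L"
  shows "real (afld_bits \<delta> A B L \<gamma> (concat Ys)) \<le>
    2 * log 2 (B * L) + 1 + B * (L / n + 1) * (2 + log 2 (B * L)) +
    n * (B + card T + (\<Sum>y\<leftarrow>Ys. card {i. i < L div n \<and> chunk n i y \<notin> T}))"
proof -
  define cs where "cs = concat (map (pieces n) Ys)"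
  let ?R = "B + card T + (\<Sum>y\<leftarrow>Ys. card {i. i < L div n \<and> chunk n i y \<notin> T})"
  have enc: "afld \<delta> A B L \<gamma> (concat Ys) = elias_gamma (length (concat cs)) @ encode_chunks [] cs"
    using pieces_concat[of L Ys] L Ys(2) by (simp add: afld_def dictionary_encoding_def cs_def n_def)
  have concat_cs: "concat cs = concat Ys"
    unfolding cs_def by (induction Ys) auto
  have "sum_list (map length Ys) = sum_list (map (\<lambda>_. L) Ys)"
    using Ys(2) by (intro arg_cong[where f = sum_list] map_cong) auto
  then have len_s: "length (concat cs) = B * L"
    by (simp add: concat_cs length_concat sum_list_triv Ys(1))
  have len_cs: "length cs = (\<Sum>y\<leftarrow>Ys. length (pieces n y))"
    by (simp add: cs_def length_concat comp_def)
  also have "\<dots> \<le> (\<Sum>y\<leftarrow>Ys. Suc (L div n))"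
    using length_pieces_le(1)[OF n] Ys(2) by (intro sum_list_mono) fastforce
  finally have N1: "length cs \<le> B * Suc (L div n)" by (simp add: sum_list_triv Ys(1))
  have "(\<Sum>y\<leftarrow>Ys. length (pieces n y)) \<le> (\<Sum>y\<leftarrow>Ys. L)"
    using length_pieces_le(2)[OF n] Ys(2) by (intro sum_list_mono) fastforce
  then have N2: "length cs \<le> B * L" by (simp add: len_cs sum_list_triv Ys(1))
  have BL: "0 < B * L" using B L by simp
  have "real (length cs) \<le> B * real (Suc (L div n))"
    using N1 by (metis of_nat_le_iff of_nat_mult)
  also have "\<dots> \<le> B * (L / n + 1)"
    using of_nat_div_le_of_nat[of L n, where 'a = real] by (intro mult_left_mono) auto
  finally have N1': "real (length cs) \<le> B * (L / n + 1)" .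
  have "0 \<le> log 2 (real (B * L))" using BL by (simp del: of_nat_mult)
  \<comment> \<open>One bit is the flag, and rounding the pointer width up costs at most one
    more.\<close>
  then have w: "real (1 + nat \<lceil>log 2 (real (B * L))\<rceil>) \<le> 2 + log 2 (B * L)"
    by (simp del: of_nat_mult) linarith
  have "(\<Sum>c\<in>set cs. length c) \<le> (\<Sum>c\<in>set cs. n)"
  proof (rule sum_mono)
    fix c assume "c \<in> set cs"
    then show "length c \<le> n"
      using set_pieces_subset[OF n] by (fastforce simp: cs_def chunk_def)
  qed
  also have "\<dots> = n * card (\<Union>y\<in>set Ys. set (pieces n y))"
    by (simp add: cs_def)
  also have "\<dots> \<le> n * ?R"
    using card_chunks_le[OF n Ys(2) T, of Ys] Ys(1) by (intro mult_left_mono) auto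
  finally have "(\<Sum>c\<in>set cs. length c) \<le> n * ?R" .
  then have "length (encode_chunks [] cs) \<le> length cs * (1 + nat \<lceil>log 2 (real (B * L))\<rceil>) + n * ?R"
    using length_encode_chunks_le[of "[]" cs "B * L"] N2 by simp
  then have "real (length (encode_chunks [] cs)) \<le>
      real (length cs) * real (1 + nat \<lceil>log 2 (real (B * L))\<rceil>) + real (n * ?R)"
    by (simp only: of_nat_le_iff flip: of_nat_add of_nat_mult)
  also have "\<dots> \<le> B * (L / n + 1) * (2 + log 2 (B * L)) + real (n * ?R)"
    by (intro add_right_mono mult_mono N1' w) auto
  finally show ?thesis
    using length_elias_gamma_le[OF BL] by (simp add: afld_bits_def enc len_s)
qed

section \<open>Typical edits\<close>

definition weight :: "bool list \<Rightarrow> nat" where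
  "weight e = length (filter id e)"

text \<open>The number of flips is bounded from above only: for \<delta> < 1/2 a pattern with fewer
  flips is more probable, which is all that the counting argument requires.\<close>

definition typical :: "real \<Rightarrow> nat \<Rightarrow> bool list set" where
  "typical \<gamma> n = {e. length e = n \<and> real (weight e) \<le> \<gamma> * n}"

lemma finite_typical: "finite (typical \<gamma> n)"
  by (rule finite_subset[OF _ finite_lists_length_eq[of "UNIV :: bool set" n]]) (auto simp: typical_def)

lemma pmf_replicate_bernoulli:
  assumes "0 \<le> \<delta>" "\<delta> \<le> 1"
  shows "pmf (replicate_pmf (length e) (bernoulli_pmf \<delta>)) e =
    \<delta> ^ weight e * (1 - \<delta>) ^ (length e - weight e)"
proof (induction e)
  case Nil
  show ?case by (simp add: weight_def)
next
  case (Cons b e)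
  have "weight e \<le> length e" by (simp add: weight_def)
  then show ?case
    using Cons assms
    by (cases b) (auto simp: pmf_replicate_pmf_Cons weight_def Suc_diff_le simp del: replicate_pmf.simps)
qed

lemma card_typical_le:
  assumes "0 < \<delta>" "\<delta> < 1 / 2"
  shows "card (typical \<gamma> n) \<le> 2 powr (n * cross_entropy \<gamma> \<delta>)"
proof -
  let ?p = "replicate_pmf n (bernoulli_pmf \<delta>)" and ?c = "2 powr (- (n * cross_entropy \<gamma> \<delta>))"
  have ge: "?c \<le> pmf ?p e" if "e \<in> typical \<gamma> n" for e
  proof -
    have e: "length e = n" "real (weight e) \<le> \<gamma> * n" "weight e \<le> n"
      using that by (auto simp: typical_def weight_def)
    \<comment> \<open>Trading non-flips for flips up to \<gamma> n of them only lowers the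
      probability, as \<delta> < 1 - \<delta>; the lower extreme is 2 to the power -n H(\<gamma>,
      \<delta>).\<close>
    have "(\<gamma> * n - weight e) * log 2 \<delta> \<le> (\<gamma> * n - weight e) * log 2 (1 - \<delta>)"
      using assms e by (intro mult_left_mono) auto
    then have "- (n * cross_entropy \<gamma> \<delta>) \<le> weight e * log 2 \<delta> + (n - weight e) * log 2 (1 - \<delta>)"
      using assms e(3) by (simp add: cross_entropy_def log_divide of_nat_diff algebra_simps)
    then have "?c \<le> 2 powr (weight e * log 2 \<delta> + (n - weight e) * log 2 (1 - \<delta>))"
      by (rule powr_mono) simp
    also have "\<dots> = (2 powr log 2 \<delta>) powr weight e * (2 powr log 2 (1 - \<delta>)) powr (n - weight e)"
      unfolding powr_add powr_powr by (simp add: mult.commute)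
    also have "\<dots> = pmf ?p e"
      using assms pmf_replicate_bernoulli[of \<delta> e] e
      by (simp add: powr_realpow flip: of_nat_diff)
    finally show ?thesis .
  qed
  have "card (typical \<gamma> n) * ?c \<le> sum (pmf ?p) (typical \<gamma> n)"
    using sum_bounded_below[of "typical \<gamma> n" ?c "pmf ?p"] ge by simp
  also have "\<dots> \<le> 1"
    using measure_pmf.prob_le_1[of ?p "typical \<gamma> n"]
    by (simp add: measure_measure_pmf_finite[OF finite_typical])
  finally show ?thesis by (simp add: powr_minus field_simps)
qed

text \<open>The i.i.d. list splits into independent parts before, inside and after the chunk, and
  the outer two integrate out. The bound on \<open>i\<close> guarantees a full chunk.\<close>

lemma map_pmf_chunk_replicate:
  assumes "i < L div n"
  shows "map_pmf (chunk n i) (replicate_pmf L p) = replicate_pmf n p"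
proof -
  have "i * n + n \<le> L"
    using assms by (metis Suc_leI add.commute div_times_less_eq_dividend mult_Suc mult_le_mono1 order.trans)
  then obtain k where L: "L = i * n + (n + k)" by (metis add.assoc le_Suc_ex)
  let ?r = "\<lambda>m. replicate_pmf m p"
  have "map_pmf (chunk n i) (?r L) =
      bind_pmf (?r (i * n)) (\<lambda>xs. bind_pmf (?r n) (\<lambda>ys. bind_pmf (?r k) (\<lambda>zs. return_pmf (chunk n i (xs @ ys @ zs)))))"
    unfolding L replicate_pmf_distrib map_bind_pmf bind_assoc_pmf bind_return_pmf map_return_pmf ..
  also have "\<dots> = bind_pmf (?r (i * n)) (\<lambda>xs. bind_pmf (?r n) (\<lambda>ys. bind_pmf (?r k) (\<lambda>zs. return_pmf ys)))"
    by (intro bind_pmf_cong refl) (auto simp: chunk_def set_replicate_pmf)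
  also have "\<dots> = ?r n" by (simp add: bind_return_pmf')
  finally show ?thesis .
qed

lemma prob_atypical_le:
  assumes "0 < \<delta>" "\<delta> < 1" "\<delta> \<le> \<gamma>" "0 < n"
  shows "measure_pmf.prob (replicate_pmf n (bernoulli_pmf \<delta>)) (- typical \<gamma> n) \<le> exp (- 2 * real n * (\<gamma> - \<delta>)\<^sup>2)"
proof -
  interpret binomial_distribution n \<delta> using assms by unfold_locales auto
  let ?p = "replicate_pmf n (bernoulli_pmf \<delta>)"
  \<comment> \<open>The complement of \<open>typical\<close> also contains lists of other lengths,
    which have probability 0, so the inclusion holds almost surely. The weight is binomial, and
    Hoeffding's inequality applies with deviation \<gamma> - \<delta>.\<close>
  have "measure_pmf.prob ?p (- typical \<gamma> n) \<le> measure_pmf.prob ?p (weight -` {x. \<delta> + (\<gamma> - \<delta>) \<le> x / n})"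
    using assms(4) by (intro measure_pmf.finite_measure_mono_AE)
      (auto simp: AE_measure_pmf_iff set_replicate_pmf typical_def field_simps)
  also have "\<dots> = measure_pmf.prob (binomial_pmf n \<delta>) {x. \<delta> + (\<gamma> - \<delta>) \<le> x / n}"
    using assms by (simp add: binomial_pmf_altdef comp_def weight_def[abs_def])
  also have "\<dots> \<le> exp (- 2 * real n * (\<gamma> - \<delta>)\<^sup>2)"
    using prob_ge'[of "\<gamma> - \<delta>"] assms by (simp add: mult.assoc)
  finally show ?thesis .
qed

text \<open>This set serves as \<open>T\<close> above, with \<open>q\<close> the number of full
  chunks per source symbol. It depends on the source symbols only, not on the choice of the blocks
  or their edits.\<close>

definition typical_chunks :: "real \<Rightarrow> nat \<Rightarrow> nat \<Rightarrow> bool list list \<Rightarrow> bool list set" where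
  "typical_chunks \<gamma> n q Xs = (\<Union>X\<in>set Xs. \<Union>i<q. map2 (\<noteq>) (chunk n i X) ` typical \<gamma> n)"

lemma finite_typical_chunks: "finite (typical_chunks \<gamma> n q Xs)"
  by (auto simp: typical_chunks_def finite_typical)

lemma card_typical_chunks_le: "card (typical_chunks \<gamma> n q Xs) \<le> length Xs * (q * card (typical \<gamma> n))"
proof -
  have "card (\<Union>i<q. map2 (\<noteq>) (chunk n i X) ` typical \<gamma> n) \<le> q * card (typical \<gamma> n)" for X
  proof -
    have "card (\<Union>i<q. map2 (\<noteq>) (chunk n i X) ` typical \<gamma> n) \<le>
        (\<Sum>i<q. card (map2 (\<noteq>) (chunk n i X) ` typical \<gamma> n))"
      by (rule card_UN_le) simp
    also have "\<dots> \<le> (\<Sum>i<q. card (typical \<gamma> n))"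
      by (intro sum_mono card_image_le finite_typical)
    finally show ?thesis by simp
  qed
  then have "(\<Sum>X\<leftarrow>Xs. card (\<Union>i<q. map2 (\<noteq>) (chunk n i X) ` typical \<gamma> n)) \<le>
      (\<Sum>X\<leftarrow>Xs. q * card (typical \<gamma> n))"
    by (intro sum_list_mono)
  then show ?thesis
    using card_UN_list_le[of "\<lambda>X. \<Union>i<q. map2 (\<noteq>) (chunk n i X) ` typical \<gamma> n" Xs]
    by (simp add: typical_chunks_def sum_list_triv)
qed

lemma chunk_map2: "chunk n i (map2 f xs ys) = map2 f (chunk n i xs) (chunk n i ys)"
  by (simp add: chunk_def take_map drop_map take_zip drop_zip)

lemma expectation_edit_atypical_le:
  assumes X: "X \<in> set Xs" "length X = L"
    and \<delta>: "0 < \<delta>" "\<delta> < 1" "\<delta> \<le> \<gamma>" and n: "0 < n"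
  shows "measure_pmf.expectation (edit_pmf \<delta> X)
      (\<lambda>y. real (card {i. i < L div n \<and> chunk n i y \<notin> typical_chunks \<gamma> n (L div n) Xs}))
    \<le> real (L div n) * exp (- 2 * real n * (\<gamma> - \<delta>)\<^sup>2)"
proof -
  let ?p = "replicate_pmf L (bernoulli_pmf \<delta>)"
  let ?q = "L div n"
  have fin: "finite (set_pmf ?p)" by (simp add: finite_set_replicate_pmf)
  have "real (card {i. i < ?q \<and> chunk n i (map2 (\<noteq>) X e) \<notin> typical_chunks \<gamma> n ?q Xs}) \<le>
      (\<Sum>i<?q. indicator (chunk n i -` (- typical \<gamma> n)) e)" for e
  proof -
    \<comment> \<open>Edits commute with cutting. As \<open>X\<close> is one of the source symbols,
      a typical pattern at position \<open>i\<close> would put the edited chunk into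
      \<open>typical_chunks\<close>.\<close>
    have "{i. i < ?q \<and> chunk n i (map2 (\<noteq>) X e) \<notin> typical_chunks \<gamma> n ?q Xs} \<subseteq>
        {i. i < ?q \<and> chunk n i e \<notin> typical \<gamma> n}"
      using X(1) unfolding chunk_map2 typical_chunks_def by blast
    then have "card {i. i < ?q \<and> chunk n i (map2 (\<noteq>) X e) \<notin> typical_chunks \<gamma> n ?q Xs} \<le>
        card {i. i < ?q \<and> chunk n i e \<notin> typical \<gamma> n}"
      by (intro card_mono) auto
    also have "real \<dots> = (\<Sum>i<?q. indicator (chunk n i -` (- typical \<gamma> n)) e)"
      by (simp add: indicator_def of_bool_def sum.If_cases flip: sum.inter_filter)
        (simp add: Collect_conj_eq lessThan_def)
    finally show ?thesis by simp
  qed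
  then have "measure_pmf.expectation (edit_pmf \<delta> X)
      (\<lambda>y. real (card {i. i < ?q \<and> chunk n i y \<notin> typical_chunks \<gamma> n ?q Xs})) \<le>
      measure_pmf.expectation ?p (\<lambda>e. \<Sum>i<?q. indicator (chunk n i -` (- typical \<gamma> n)) e)"
    using fin by (simp add: edit_pmf_def X(2) expectation_mono_finite)
  also have "\<dots> = (\<Sum>i<?q. measure_pmf.prob ?p (chunk n i -` (- typical \<gamma> n)))"
    using fin by (subst Bochner_Integration.integral_sum) (auto simp: integrable_measure_pmf_finite)
  also have "\<dots> = (\<Sum>i<?q. measure_pmf.prob (replicate_pmf n (bernoulli_pmf \<delta>)) (- typical \<gamma> n))"
    by (intro sum.cong refl) (simp flip: measure_map_pmf add: map_pmf_chunk_replicate)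
  also have "\<dots> \<le> (\<Sum>i<?q. exp (- 2 * real n * (\<gamma> - \<delta>)\<^sup>2))"
    by (intro sum_mono prob_atypical_le \<delta> n)
  finally show ?thesis by simp
qed

section \<open>Expected code length for finite parameters\<close>

lemma expectation_sum_list_replicate:
  fixes g :: "'a \<Rightarrow> real"
  assumes fin: "finite (set_pmf p)"
  shows "measure_pmf.expectation (replicate_pmf n p) (\<lambda>xs. \<Sum>x\<leftarrow>xs. g x) = n * measure_pmf.expectation p g"
proof (induction n)
  case (Suc n)
  have fin': "finite (set_pmf (replicate_pmf n p))" by (rule finite_set_replicate_pmf[OF fin])
  have "measure_pmf.expectation (replicate_pmf (Suc n) p) (\<lambda>xs. \<Sum>x\<leftarrow>xs. g x) =
      measure_pmf.expectation p (\<lambda>x. measure_pmf.expectation (replicate_pmf n p) (\<lambda>xs. g x + (\<Sum>x\<leftarrow>xs. g x)))"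
    using fin fin' by (simp add: expectation_bind_pmf_finite)
  also have "\<dots> = measure_pmf.expectation p g + n * measure_pmf.expectation p g"
    using fin fin' Suc by (simp add: integrable_measure_pmf_finite)
  finally show ?case by (simp add: algebra_simps)
qed simp

lemma expectation_blocks_atypical_le:
  assumes A: "0 < A" and Xs: "Xs \<in> set_pmf (symbols_pmf A L)"
    and \<delta>: "0 < \<delta>" "\<delta> < 1" "\<delta> \<le> \<gamma>" and n: "0 < n"
  shows "measure_pmf.expectation (replicate_pmf B (block_pmf \<delta> Xs))
      (\<lambda>Ys. \<Sum>y\<leftarrow>Ys. real (card {i. i < L div n \<and> chunk n i y \<notin> typical_chunks \<gamma> n (L div n) Xs}))
    \<le> B * (real (L div n) * exp (- 2 * real n * (\<gamma> - \<delta>)\<^sup>2))"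
proof -
  have "measure_pmf.expectation (block_pmf \<delta> Xs)
      (\<lambda>y. real (card {i. i < L div n \<and> chunk n i y \<notin> typical_chunks \<gamma> n (L div n) Xs}))
    \<le> real (L div n) * exp (- 2 * real n * (\<gamma> - \<delta>)\<^sup>2)"
    unfolding block_pmf_def
  proof (subst expectation_bind_pmf_finite)
    show "finite (set_pmf (pmf_of_set {..<length Xs}))"
      using set_index_pmf[OF A Xs] by simp
    then show "measure_pmf.expectation (pmf_of_set {..<length Xs}) (\<lambda>j. measure_pmf.expectation (edit_pmf \<delta> (Xs ! j))
        (\<lambda>y. real (card {i. i < L div n \<and> chunk n i y \<notin> typical_chunks \<gamma> n (L div n) Xs})))
      \<le> real (L div n) * exp (- 2 * real n * (\<gamma> - \<delta>)\<^sup>2)"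
      using set_index_pmf[OF A Xs] Xs
      by (intro expectation_le_const_finite[OF _ expectation_edit_atypical_le[OF _ _ \<delta> n]])
        (auto simp: set_symbols_pmf)
  qed (rule finite_set_edit_pmf)
  then show ?thesis
    using finite_set_block_pmf[OF A Xs] by (simp add: expectation_sum_list_replicate mult_left_mono)
qed

text \<open>Two thresholds occur: \<gamma> fixes the chunk length, while \<gamma>' decides which
  patterns count as typical.\<close>

lemma expectation_afld_bits_le:
  fixes A B L :: nat and \<delta> \<gamma> \<gamma>' :: real
  defines "n \<equiv> afld_chunk_length \<delta> A B L \<gamma>"
  assumes pos: "0 < n" "0 < A" "0 < B" "0 < L"
    and \<delta>: "0 < \<delta>" "\<delta> < 1 / 2" "\<delta> \<le> \<gamma>'"
  shows "measure_pmf.expectation (source_pmf \<delta> A B L) (\<lambda>s. real (afld_bits \<delta> A B L \<gamma> s)) \<le>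
    2 * log 2 (B * L) + 1 + B * (L / n + 1) * (2 + log 2 (B * L)) +
    n * B + A * L * 2 powr (n * cross_entropy \<gamma>' \<delta>) + B * L * exp (- 2 * real n * (\<gamma>' - \<delta>)\<^sup>2)"
  (is "_ \<le> ?R")
proof -
  let ?q = "L div n"
  have \<delta>1: "\<delta> < 1" using \<delta> by simp
  \<comment> \<open>The full chunks of a block cover at most L bits; this turns chunk counts into
    the factor L in the last two summands.\<close>
  have nq: "real n * real ?q \<le> L"
    by (metis div_times_less_eq_dividend mult.commute of_nat_le_iff of_nat_mult)
  \<comment> \<open>The bound is uniform in the source symbols, so it survives averaging over
    them.\<close>
  have *: "measure_pmf.expectation (replicate_pmf B (block_pmf \<delta> Xs)) (\<lambda>Ys. real (afld_bits \<delta> A B L \<gamma> (concat Ys))) \<le> ?R"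
    if Xs: "Xs \<in> set_pmf (symbols_pmf A L)" for Xs
  proof -
    let ?P = "replicate_pmf B (block_pmf \<delta> Xs)" and ?T = "typical_chunks \<gamma>' n ?q Xs"
    let ?bad = "\<lambda>Ys. \<Sum>y\<leftarrow>Ys. real (card {i. i < ?q \<and> chunk n i y \<notin> ?T})"
    let ?C = "2 * log 2 (B * L) + 1 + B * (L / n + 1) * (2 + log 2 (B * L))"
    note fin = finite_set_blocks_pmf[OF pos(2) Xs, of B \<delta>]
    have "real (card ?T) \<le> real A * (real ?q * real (card (typical \<gamma>' n)))"
      using card_typical_chunks_le[of \<gamma>' n ?q Xs] Xs
      by (simp only: set_symbols_pmf mem_Collect_eq flip: of_nat_mult)
    also have "\<dots> \<le> real A * (real ?q * 2 powr (n * cross_entropy \<gamma>' \<delta>))"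
      using \<delta> by (intro mult_left_mono card_typical_le) auto
    finally have "n * real (card ?T) \<le> n * (real A * (real ?q * 2 powr (n * cross_entropy \<gamma>' \<delta>)))"
      by (intro mult_left_mono) auto
    also have "\<dots> = A * (real n * real ?q) * 2 powr (n * cross_entropy \<gamma>' \<delta>)"
      by simp
    also have "\<dots> \<le> A * L * 2 powr (n * cross_entropy \<gamma>' \<delta>)"
      using nq by (intro mult_right_mono) (auto intro!: mult_left_mono)
    finally have T: "n * real (card ?T) \<le> A * L * 2 powr (n * cross_entropy \<gamma>' \<delta>)" .
    have "n * measure_pmf.expectation ?P ?bad \<le> n * (B * (real ?q * exp (- 2 * real n * (\<gamma>' - \<delta>)\<^sup>2)))"
      by (intro mult_left_mono expectation_blocks_atypical_le[OF pos(2) Xs \<delta>(1) \<delta>1 \<delta>(3) pos(1)]) simp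
    also have "\<dots> = B * (real n * real ?q) * exp (- 2 * real n * (\<gamma>' - \<delta>)\<^sup>2)"
      by simp
    also have "\<dots> \<le> B * L * exp (- 2 * real n * (\<gamma>' - \<delta>)\<^sup>2)"
      using nq by (intro mult_right_mono) (auto intro!: mult_left_mono)
    finally have bad: "n * measure_pmf.expectation ?P ?bad \<le> B * L * exp (- 2 * real n * (\<gamma>' - \<delta>)\<^sup>2)" .
    have "measure_pmf.expectation ?P (\<lambda>Ys. real (afld_bits \<delta> A B L \<gamma> (concat Ys))) \<le>
        measure_pmf.expectation ?P (\<lambda>Ys. ?C + n * (B + card ?T + ?bad Ys))"
    proof (rule expectation_mono_finite[OF fin])
      fix Ys assume "Ys \<in> set_pmf ?P"
      then have Ys: "length Ys = B" "\<And>y. y \<in> set Ys \<Longrightarrow> length y = L"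
        using set_block_pmf_length[OF pos(2) Xs] by (auto simp: set_replicate_pmf)
      have "?bad Ys = real (\<Sum>y\<leftarrow>Ys. card {i. i < ?q \<and> chunk n i y \<notin> ?T})"
        by (induction Ys) auto
      then show "real (afld_bits \<delta> A B L \<gamma> (concat Ys)) \<le> ?C + n * (B + card ?T + ?bad Ys)"
        using afld_bits_le[of \<delta> A B L \<gamma> ?T Ys] pos Ys finite_typical_chunks
        unfolding n_def[symmetric] by simp
    qed
    also have "\<dots> = ?C + n * B + n * real (card ?T) + n * measure_pmf.expectation ?P ?bad"
      using fin by (simp add: integrable_measure_pmf_finite algebra_simps)
    also have "\<dots> \<le> ?R" using T bad by simp
    finally show ?thesis .
  qed
  have "measure_pmf.expectation (source_pmf \<delta> A B L) (\<lambda>s. real (afld_bits \<delta> A B L \<gamma> s)) =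
      measure_pmf.expectation (symbols_pmf A L) (\<lambda>Xs. measure_pmf.expectation (replicate_pmf B (block_pmf \<delta> Xs))
        (\<lambda>Ys. real (afld_bits \<delta> A B L \<gamma> (concat Ys))))"
    unfolding source_pmf_alt
    using finite_set_blocks_pmf[OF pos(2)]
    by (subst expectation_bind_pmf_finite) (auto simp: finite_set_symbols_pmf)
  also have "\<dots> \<le> ?R"
    by (intro expectation_le_const_finite finite_set_symbols_pmf *)
  finally show ?thesis .
qed

section \<open>Affine cross entropy and the limit of the code rate\<close>

section \<open>Asymptotics\<close>

text \<open>The slope is positive for \<delta> < 1/2. This gives both the strict monotonicity and an
  explicit choice of \<gamma> close to \<delta>.\<close>

lemma cross_entropy_affine:
  assumes "0 < \<delta>" "\<delta> < 1"
  shows "cross_entropy p \<delta> = cross_entropy \<delta> \<delta> + (p - \<delta>) * log 2 ((1 - \<delta>) / \<delta>)"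
  using assms by (simp add: cross_entropy_def log_divide algebra_simps)

lemma cross_entropy_strict_mono:
  assumes "0 < \<delta>" "\<delta> < 1 / 2" "p < q"
  shows "cross_entropy p \<delta> < cross_entropy q \<delta>"
  using assms by (simp add: cross_entropy_affine[of \<delta> p] cross_entropy_affine[of \<delta> q])

lemma cross_entropy_self_pos:
  assumes "0 < \<delta>" "\<delta> < 1"
  shows "0 < cross_entropy \<delta> \<delta>"
proof -
  have "0 < \<delta> * log 2 (1 / \<delta>)" "0 < (1 - \<delta>) * log 2 (1 / (1 - \<delta>))"
    using assms by simp_all
  then show ?thesis by (simp add: cross_entropy_def)
qed

lemma exists_cross_entropy_le:
  assumes "0 < \<delta>" "\<delta> < 1 / 2" "1 < a"
  obtains \<gamma> where "\<delta> < \<gamma>" "\<gamma> < 1 / 2" "cross_entropy \<gamma> \<delta> \<le> a * cross_entropy \<delta> \<delta>"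
proof
  let ?h = "cross_entropy \<delta> \<delta>" and ?l = "log 2 ((1 - \<delta>) / \<delta>)"
  \<comment> \<open>The first cap is half the distance to 1/2, so \<delta> + t stays strictly below
    it; the second is the point where the affine function reaches a H(\<delta>, \<delta>).\<close>
  define t where "t = min ((1 / 2 - \<delta>) / 2) ((a - 1) * ?h / ?l)"
  have pos: "0 < ?h" "0 < ?l" using assms by (auto intro: cross_entropy_self_pos)
  have "t \<le> (1 / 2 - \<delta>) / 2" unfolding t_def by (rule min.cobounded1)
  also have "\<dots> < 1 / 2 - \<delta>" using assms by simp
  finally show "\<delta> + t < 1 / 2" by simp
  have "0 < t" using assms pos by (simp add: t_def)
  then show "\<delta> < \<delta> + t" by simp
  have "t \<le> (a - 1) * ?h / ?l" unfolding t_def by (rule min.cobounded2)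
  then have "t * ?l \<le> (a - 1) * ?h" using pos(2) by (simp only: pos_le_divide_eq)
  then show "cross_entropy (\<delta> + t) \<delta> \<le> a * ?h"
    using assms by (simp add: cross_entropy_affine[of \<delta> "\<delta> + t"] algebra_simps)
qed

text \<open>A bound on the expected number of code bits per bit of data, with \<open>G = H(\<gamma>, \<delta>)\<close>,
  \<open>G' = H(\<gamma>', \<delta>)\<close>, \<open>e = \<gamma>' - \<delta>\<close> and \<open>c1 B\<^sup>k\<^sup>1 \<le> L \<le> c2 B\<^sup>k\<^sup>1\<close>. The summands account for the
  length header, the pointers, the incomplete chunks, the typical new chunks and the atypical
  new chunks; only the pointers survive in the limit.\<close>

definition rate :: "real \<Rightarrow> real \<Rightarrow> real \<Rightarrow> real \<Rightarrow> real \<Rightarrow> real \<Rightarrow> real \<Rightarrow> real \<Rightarrow> real" where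
  "rate G G' e k1 k2 c1 c2 B =
     (1 / (c1 * B powr k1)) * (2 * ((1 + k1) * log 2 B + log 2 c2) + 1)
     + (G / (k2 * log 2 B) + 1 / (c1 * B powr k1)) * (2 + ((1 + k1) * log 2 B + log 2 c2))
     + (log 2 B / G + 1) * (1 / (c1 * B powr k1))
     + 2 powr G' * 2 powr (- (k2 * log 2 B * (1 - G' / G)))
     + exp (- 2 * (k2 * log 2 B / G) * e\<^sup>2)"

lemma rate_tendsto:
  assumes "0 < G" "G' < G" "0 < e" "0 < k1" "0 < k2" "0 < c1"
  shows "((\<lambda>B. rate G G' e k1 k2 c1 c2 (real B)) \<longlongrightarrow> G * (1 + k1) / k2) sequentially"
proof -
  \<comment> \<open>The gap between G' and G makes \<open>u\<close> positive, and e > 0 makes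
    \<open>v\<close> positive, so the last two summands are negative powers of B.\<close>
  define u where "u = k2 * (1 - G' / G)"
  define v where "v = 2 * k2 * e\<^sup>2 / G"
  have u: "0 < u" using assms by (simp add: u_def)
  have v: "0 < v" using assms by (simp add: v_def)
  have 1: "(\<lambda>B. (1 / (c1 * real B powr k1)) * (2 * ((1 + k1) * log 2 (real B) + log 2 c2) + 1)) \<longlonglongrightarrow> 0"
    using assms(4,6) by real_asymp
  \<comment> \<open>The logarithm in the pointer width cancels the one in the chunk length.\<close>
  have 2: "(\<lambda>B. (G / (k2 * log 2 (real B)) + 1 / (c1 * real B powr k1)) * (2 + ((1 + k1) * log 2 (real B) + log 2 c2)))
     \<longlonglongrightarrow> G * (1 + k1) / k2"
    using assms(1,4-6) by (real_asymp simp: field_simps)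
  have 3: "(\<lambda>B. (log 2 (real B) / G + 1) * (1 / (c1 * real B powr k1))) \<longlonglongrightarrow> 0"
    using assms(1,4,6) by real_asymp
  have 4: "(\<lambda>B. 2 powr G' * 2 powr (- (u * log 2 (real B)))) \<longlonglongrightarrow> 0"
    using u by real_asymp
  have 5: "(\<lambda>B. exp (- (v * log 2 (real B)))) \<longlonglongrightarrow> 0"
    using v by real_asymp
  have "(\<lambda>B. (1 / (c1 * real B powr k1)) * (2 * ((1 + k1) * log 2 (real B) + log 2 c2) + 1)
     + (G / (k2 * log 2 (real B)) + 1 / (c1 * real B powr k1)) * (2 + ((1 + k1) * log 2 (real B) + log 2 c2))
     + (log 2 (real B) / G + 1) * (1 / (c1 * real B powr k1))
     + 2 powr G' * 2 powr (- (u * log 2 (real B)))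
     + exp (- (v * log 2 (real B)))) \<longlonglongrightarrow> 0 + G * (1 + k1) / k2 + 0 + 0 + 0"
    by (intro tendsto_add 1 2 3 4 5)
  moreover have eq: "k2 * x * (1 - G' / G) = u * x" "- 2 * (k2 * x / G) * e\<^sup>2 = - (v * x)" for x
    by (simp_all add: u_def v_def)
  ultimately show ?thesis unfolding rate_def eq by simp
qed

text \<open>Every asymptotic assumption appears here as an inequality at a single B, so that the
  limit can be taken in \<open>rate\<close> alone.\<close>

lemma expectation_afld_bits_le_rate:
  fixes A B L :: nat and \<delta> \<gamma> \<gamma>' k1 k2 c1 c2 :: real
  defines "G \<equiv> cross_entropy \<gamma> \<delta>" and "G' \<equiv> cross_entropy \<gamma>' \<delta>"
  assumes \<delta>: "0 < \<delta>" "\<delta> < 1 / 2" "\<delta> < \<gamma>'" "\<gamma>' < \<gamma>"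
    and k: "0 < k1" "0 < k2" "k2 < 1" and c: "0 < c1"
    and B: "2 \<le> B" and A: "1 \<le> A" "A \<le> B powr (1 - k2)"
    and L: "1 \<le> L" "c1 * B powr k1 \<le> L" "L \<le> c2 * B powr k1" "log 2 B / G + 1 \<le> L"
  shows "measure_pmf.expectation (source_pmf \<delta> A B L) (\<lambda>s. real (afld_bits \<delta> A B L \<gamma> s)) \<le>
    real B * real L * rate G G' (\<gamma>' - \<delta>) k1 k2 c1 c2 B"
proof -
  have G': "0 < G'" "G' < G"
    using cross_entropy_self_pos[of \<delta>] cross_entropy_strict_mono[of \<delta> \<delta> \<gamma>']
      cross_entropy_strict_mono[of \<delta> \<gamma>' \<gamma>] \<delta> by (auto simp: G_def G'_def)
  then have G: "0 < G" by simp
  define lb where "lb = log 2 (real B)"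
  define x where "x = log 2 (real B / real A)"
  define n where "n = afld_chunk_length \<delta> A B L \<gamma>"
  \<comment> \<open>\<open>U\<close> will dominate log (B L), and \<open>V\<close> both 1 / L and 1
    / (B L).\<close>
  define U where "U = (1 + k1) * lb + log 2 c2"
  define V where "V = 1 / (c1 * B powr k1)"
  have lb: "1 \<le> lb" unfolding lb_def using B by (subst le_log_iff) auto
  have x_eq: "x = lb - log 2 A" unfolding x_def lb_def using A B by (simp add: log_divide)
  \<comment> \<open>The bound on A gives log (B / A) \<ge> k2 log B; A \<ge> 1 gives log (B / A)
    \<le> log B.\<close>
  have "log 2 A \<le> log 2 (B powr (1 - k2))" using A B by (subst log_le_cancel_iff) auto
  also have "\<dots> = (1 - k2) * lb" using B by (simp add: log_powr lb_def)
  finally have x_ge: "k2 * lb \<le> x" unfolding x_eq by (simp add: algebra_simps)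
  have x_le: "x \<le> lb" unfolding x_eq using A by simp
  have x_pos: "0 < x" using x_ge k lb by (smt (verit) mult_pos_pos)
  define m where "m = nat \<lceil>x / G\<rceil>"
  have m_ge: "x / G \<le> m" unfolding m_def by linarith
  have "0 \<le> x / G" using x_pos G by simp
  then have m_le: "m \<le> x / G + 1" unfolding m_def by linarith
  have "x / G \<le> lb / G" using x_le G by (simp add: divide_right_mono)
  then have m_le': "m \<le> lb / G + 1" using m_le by simp
  \<comment> \<open>L is large enough for the minimum with D = L in the chunk length to be attained
    by the ceiling.\<close>
  then have "real m \<le> real L" using L(4) unfolding lb_def by linarith
  then have n_eq: "n = m" by (simp add: n_def afld_chunk_length_def m_def x_def G_def)
  have "k2 * lb / G \<le> x / G" using x_ge G by (simp add: divide_right_mono)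
  then have n_ge: "k2 * lb / G \<le> n" using m_ge n_eq by simp
  have klb: "0 < k2 * lb / G" using k lb G by simp
  then have n_pos: "0 < real n" using n_ge by simp
  have BL: "0 < real B" "0 < real L" "1 \<le> real B" using B L by auto
  have c2: "0 < c2" using L(3) BL by (smt (verit) mult_nonpos_nonneg powr_ge_zero)
  have "log 2 (real B * real L) = lb + log 2 L" using BL by (simp add: log_mult lb_def)
  also have "log 2 L \<le> log 2 (c2 * B powr k1)" using L BL c2 by (subst log_le_cancel_iff) auto
  also have "\<dots> = log 2 c2 + k1 * lb" using BL c2 by (simp add: log_mult log_powr lb_def)
  finally have U: "log 2 (real B * real L) \<le> U" by (simp add: U_def algebra_simps)
  have U0: "0 \<le> log 2 (real B * real L)" using BL L(1) mult_mono[of 1 "real B" 1 "real L"] by simp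
  have V: "1 / L \<le> V" unfolding V_def using L BL c by (intro divide_left_mono) auto
  have V': "1 / (real B * real L) \<le> V"
    using V BL by (intro order.trans[OF _ V] divide_left_mono) auto
  have V0: "0 \<le> V" unfolding V_def using c by simp
  have inv_n: "1 / n \<le> G / (k2 * lb)"
    using le_imp_inverse_le[OF n_ge klb] by (simp add: inverse_eq_divide)
  \<comment> \<open>Rounding up exceeds x / G by at most 1, which costs the constant factor 2 to the
    power G'. What remains is the negative exponent -x (1 - G' / G).\<close>
  have "n * G' \<le> (x / G + 1) * G'" using m_le n_eq G' by (intro mult_right_mono) auto
  then have "n * G' - x \<le> G' - x * (1 - G' / G)" by (simp add: algebra_simps)
  also have "\<dots> \<le> G' - (k2 * lb) * (1 - G' / G)"
    using x_ge G G' by (intro diff_left_mono mult_right_mono) auto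
  finally have ex: "n * G' - x \<le> G' - k2 * lb * (1 - G' / G)" .
  have "A / B = 2 powr (- x)"
    using A B by (simp add: x_def powr_minus)
  then have "A / B * 2 powr (n * G') = 2 powr (n * G' - x)"
    by (simp flip: powr_add)
  also have "\<dots> \<le> 2 powr (G' - k2 * lb * (1 - G' / G))" using ex by simp
  also have "\<dots> = 2 powr G' * 2 powr (- (k2 * lb * (1 - G' / G)))" by (simp flip: powr_add)
  finally have typical_le: "A / B * 2 powr (n * G') \<le> 2 powr G' * 2 powr (- (k2 * lb * (1 - G' / G)))" .
  have "(k2 * lb / G) * (\<gamma>' - \<delta>)\<^sup>2 \<le> n * (\<gamma>' - \<delta>)\<^sup>2" using n_ge by (intro mult_right_mono) auto
  then have atyp: "exp (- 2 * real n * (\<gamma>' - \<delta>)\<^sup>2) \<le> exp (- 2 * (k2 * lb / G) * (\<gamma>' - \<delta>)\<^sup>2)" by simp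
  have "measure_pmf.expectation (source_pmf \<delta> A B L) (\<lambda>s. real (afld_bits \<delta> A B L \<gamma> s)) \<le>
      2 * log 2 (B * L) + 1 + B * (L / n + 1) * (2 + log 2 (B * L)) +
      n * B + A * L * 2 powr (n * G') + B * L * exp (- 2 * real n * (\<gamma>' - \<delta>)\<^sup>2)"
    using expectation_afld_bits_le[of \<delta> A B L \<gamma> \<gamma>'] n_pos A B L \<delta> unfolding n_def G'_def by simp
  \<comment> \<open>With B L factored out, the summands match those of \<open>rate\<close> one by
    one.\<close>
  also have "\<dots> = real B * real L * ((1 / (real B * real L)) * (2 * log 2 (real B * real L) + 1) +
      (1 / n + 1 / L) * (2 + log 2 (real B * real L)) + n * (1 / L) + A / B * 2 powr (n * G') +
      exp (- 2 * real n * (\<gamma>' - \<delta>)\<^sup>2))"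
    using BL n_pos by (simp add: field_simps)
  also have "\<dots> \<le> real B * real L * (V * (2 * U + 1) + (G / (k2 * lb) + V) * (2 + U) + (lb / G + 1) * V +
      2 powr G' * 2 powr (- (k2 * lb * (1 - G' / G))) + exp (- 2 * (k2 * lb / G) * (\<gamma>' - \<delta>)\<^sup>2))"
    using BL U U0 V V' V0 inv_n m_le' n_eq n_pos lb G k
    by (intro mult_left_mono add_mono typical_le atyp mult_mono) auto
  also have "\<dots> = real B * real L * rate G G' (\<gamma>' - \<delta>) k1 k2 c1 c2 B"
    by (simp add: rate_def V_def U_def lb_def)
  finally show ?thesis .
qed

theorem corollary4:
  fixes \<delta> a :: real
  assumes "0 < \<delta>" "\<delta> < 1 / 2" "1 < a"
  shows "\<exists>\<gamma>. \<delta> < \<gamma> \<and> \<gamma> < 1 / 2 \<and>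
    (\<forall>k1 k2 A L. asymptotic_regime k1 k2 A L \<longrightarrow>
      (\<exists>\<epsilon>\<in>o(\<lambda>B. 1). \<forall>\<^sub>F B in sequentially.
        measure_pmf.expectation (source_pmf \<delta> (A B) B (L B))
            (\<lambda>s. real (afld_bits \<delta> (A B) B (L B) \<gamma> s))
          / pmf_entropy (source_pmf \<delta> (A B) B (L B))
        \<le> a * (1 + k1) / k2 * (1 + \<epsilon> B)))"
proof -
  \<comment> \<open>\<gamma> depends on \<delta> and a alone and is fixed before the regime, so one
    value serves all k1, k2, A and L.\<close>
  obtain \<gamma> where \<gamma>: "\<delta> < \<gamma>" "\<gamma> < 1 / 2" "cross_entropy \<gamma> \<delta> \<le> a * cross_entropy \<delta> \<delta>"
    using exists_cross_entropy_le[OF assms] by blast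
  \<comment> \<open>Any point strictly between \<delta> and \<gamma> would do.\<close>
  define \<gamma>' where "\<gamma>' = (\<delta> + \<gamma>) / 2"
  define h where "h = cross_entropy \<delta> \<delta>"
  define G where "G = cross_entropy \<gamma> \<delta>"
  define G' where "G' = cross_entropy \<gamma>' \<delta>"
  have \<gamma>': "\<delta> < \<gamma>'" "\<gamma>' < \<gamma>" using \<gamma> by (auto simp: \<gamma>'_def)
  have h: "0 < h" using cross_entropy_self_pos[of \<delta>] assms by (simp add: h_def)
  have G: "h < G" "G' < G"
    using cross_entropy_strict_mono assms \<gamma> \<gamma>' by (auto simp: h_def G_def G'_def)
  then have G0: "0 < G" using h by simp
  have "\<exists>\<epsilon>\<in>o(\<lambda>B. 1). \<forall>\<^sub>F B in sequentially.
        measure_pmf.expectation (source_pmf \<delta> (A B) B (L B))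
            (\<lambda>s. real (afld_bits \<delta> (A B) B (L B) \<gamma> s))
          / pmf_entropy (source_pmf \<delta> (A B) B (L B))
        \<le> a * (1 + k1) / k2 * (1 + \<epsilon> B)"
    if regime: "asymptotic_regime k1 k2 A L" for k1 k2 A L
  proof -
    have k: "0 < k1" "0 < k2" "k2 < 1"
      and A_lim: "filterlim A at_top sequentially" and L_lim: "filterlim L at_top sequentially"
      and A_le: "\<forall>\<^sub>F B in sequentially. real (A B) \<le> real B powr (1 - k2)"
      and L_Theta: "(\<lambda>B. real (L B)) \<in> \<Theta>(\<lambda>B. real B powr k1)"
      using regime by (auto simp: asymptotic_regime_def)
    obtain c1 where c1: "0 < c1" "\<forall>\<^sub>F B in sequentially. c1 * real B powr k1 \<le> real (L B)"
      using landau_omega.bigE[OF bigthetaD2[OF L_Theta]] by auto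
    obtain c2 where c2: "\<forall>\<^sub>F B in sequentially. real (L B) \<le> c2 * real B powr k1"
      using landau_o.bigE[OF bigthetaD1[OF L_Theta]] by auto
    define C where "C = G * (1 + k1) / k2"
    define R where "R = (\<lambda>B. rate G G' (\<gamma>' - \<delta>) k1 k2 c1 c2 (real B))"
    have C: "0 < C" using G0 k by (simp add: C_def)
    have R: "R \<longlonglongrightarrow> C" unfolding R_def C_def using G G0 k c1 \<gamma>' by (intro rate_tendsto) auto
    \<comment> \<open>The absolute value makes the error nonnegative, so replacing the constant C /
      h by a larger one preserves the bound.\<close>
    define \<epsilon> where "\<epsilon> = (\<lambda>B. \<bar>R B / C - 1\<bar>)"
    have "(\<lambda>B. \<bar>R B / C - 1\<bar>) \<longlonglongrightarrow> \<bar>C / C - 1\<bar>" by (intro tendsto_intros R) (use C in simp)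
    then have "\<epsilon> \<in> o(\<lambda>B. 1)" using C by (intro smalloI_tendsto) (simp_all add: \<epsilon>_def)
    \<comment> \<open>L grows polynomially and the chunk length only logarithmically, so the cap at
      D = L is eventually inactive.\<close>
    moreover have "\<forall>\<^sub>F B in sequentially. log 2 (real B) / G + 1 \<le> c1 * real B powr k1"
      using G0 c1(1) k(1) by real_asymp
    moreover have "\<forall>\<^sub>F B in sequentially. 1 \<le> A B" "\<forall>\<^sub>F B in sequentially. 1 \<le> L B"
      using A_lim L_lim by (auto simp: filterlim_at_top)
    ultimately show ?thesis
    proof (intro bexI[of _ \<epsilon>])
      assume ev: "\<forall>\<^sub>F B in sequentially. log 2 (real B) / G + 1 \<le> c1 * real B powr k1"
        "\<forall>\<^sub>F B in sequentially. 1 \<le> A B" "\<forall>\<^sub>F B in sequentially. 1 \<le> L B"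
      show "\<forall>\<^sub>F B in sequentially.
        measure_pmf.expectation (source_pmf \<delta> (A B) B (L B))
            (\<lambda>s. real (afld_bits \<delta> (A B) B (L B) \<gamma> s))
          / pmf_entropy (source_pmf \<delta> (A B) B (L B))
        \<le> a * (1 + k1) / k2 * (1 + \<epsilon> B)"
        using ev c1(2) c2 A_le eventually_ge_at_top[of 2]
      proof eventually_elim
        case (elim B)
        let ?E = "measure_pmf.expectation (source_pmf \<delta> (A B) B (L B))
            (\<lambda>s. real (afld_bits \<delta> (A B) B (L B) \<gamma> s))"
        let ?H = "pmf_entropy (source_pmf \<delta> (A B) B (L B))"
        have BL: "0 < real B * real (L B)" using elim by simp
        have "?E \<le> real B * real (L B) * R B"
          unfolding R_def G_def G'_def
          using elim k c1(1) assms \<gamma>'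
          by (intro expectation_afld_bits_le_rate) (auto simp: G_def)
        moreover have "R B \<le> C * (1 + \<epsilon> B)"
        proof -
          have "R B = C * (1 + (R B / C - 1))" using C by simp
          also have "\<dots> \<le> C * (1 + \<epsilon> B)"
            using C by (intro mult_left_mono) (auto simp: \<epsilon>_def)
          finally show ?thesis .
        qed
        ultimately have E: "?E \<le> real B * real (L B) * (C * (1 + \<epsilon> B))"
          using BL by (smt (verit) mult_left_mono)
        have H: "real B * real (L B) * h \<le> ?H"
          unfolding h_def using assms elim by (intro pmf_entropy_source_ge) auto
        have \<epsilon>: "0 \<le> \<epsilon> B" by (simp add: \<epsilon>_def)
        have "?E / ?H \<le> real B * real (L B) * (C * (1 + \<epsilon> B)) / (real B * real (L B) * h)"
          using E H BL h C \<epsilon> by (intro frac_le) auto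
        also have "\<dots> = C / h * (1 + \<epsilon> B)" using elim by auto
        also have "\<dots> \<le> a * (1 + k1) / k2 * (1 + \<epsilon> B)"
        proof (rule mult_right_mono)
          \<comment> \<open>This is the inequality for which \<gamma> was chosen.\<close>
          have "G / h \<le> a" using \<gamma>(3) h by (simp add: G_def h_def pos_divide_le_eq)
          then have "G / h * ((1 + k1) / k2) \<le> a * ((1 + k1) / k2)"
            using k by (intro mult_right_mono) auto
          then show "C / h \<le> a * (1 + k1) / k2" by (simp add: C_def mult_ac)
        qed (use \<epsilon> in simp)
        finally show ?case .
      qed
    qed
  qed
  then show ?thesis using \<gamma> by blast
qed

end
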